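(* Let $n \ge 3$, let $\mathbf{Q}$ and $\mathbf{X}$ be real $n\times 3$ matrices of rank $3$, and let $\mathbf{I}$ be the $n\times n$ identity matrix. For $\mathbf{f} = [\mathbf{f}_1,\dots,\mathbf{f}_n]^T \in \mathbb{R}^n$ with $\mathbf{f}_i > 0$ for all $i$, put $\mathbf{F} = \mathrm{diag}(\mathbf{f})$ and $$\nu(\mathbf{f}) = \frac{1}{3}\,\mathrm{tr}\big(\mathrm{P}\{\mathbf{F}\mathbf{Q}\}\,\mathrm{P}\{\mathbf{X}\}\big).$$ Then, at every such $\mathbf{f}$, the gradient of $\nu$ with respect to $\mathbf{f}$ is $$\nabla \nu(\mathbf{f}) = \frac{2}{3}\,\mathrm{ediag}\Big(\mathbf{F}^{-1}\,\mathrm{P}\{\mathbf{F}\mathbf{Q}\}\,\mathrm{P}\{\mathbf{X}\}\,\big(\mathbf{I}-\mathrm{P}\{\mathbf{F}\mathbf{Q}\}\big)\Big).$$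
   Context: For a real $n\times 3$ matrix $\mathbf{M}$ of rank $3$, its projector is the $n\times n$ matrix $\mathrm{P}\{\mathbf{M}\} = \mathbf{M}(\mathbf{M}^T\mathbf{M})^{-1}\mathbf{M}^T$. For a vector $\mathbf{f}\in\mathbb{R}^n$, $\mathrm{diag}(\mathbf{f})$ is the $n\times n$ diagonal matrix with diagonal entries $\mathbf{f}_1,\dots,\mathbf{f}_n$. For an $n\times n$ matrix $\mathbf{N}$, $\mathrm{ediag}(\mathbf{N})\in\mathbb{R}^n$ is the vector of its diagonal entries, i.e. $\mathrm{ediag}(\mathbf{N})_i = \mathbf{N}_{ii}$. The gradient is the column vector $(\nabla\nu)_i = \partial\nu/\partial\mathbf{f}_i$. (The quantity $\nu$ is the filter-modified Vora-Value: $\mathbf{Q}$ holds the camera spectral sensitivities, $\mathbf{X}$ the CIE XYZ color matching functions, and $\mathbf{f}$ the filter transmittances.) *)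

theory Defs
  imports "HOL-Analysis.Analysis"
begin

(* An n x k matrix (n rows, k columns) has type real^'k^'n with n = CARD('n).  matrix_inv is
   meaningful only on invertible matrices: M^T M is invertible when M has full column rank. *)
definition projector :: "real^'k^'n \<Rightarrow> real^'n^'n" where
  "projector M = M ** matrix_inv (transpose M ** M) ** transpose M"

definition diag :: "real^'n \<Rightarrow> real^'n^'n" where
  "diag f = (\<chi> i j. if i = j then f $ i else 0)"

definition ediag :: "real^'n^'n \<Rightarrow> real^'n" where
  "ediag N = (\<chi> i. N $ i $ i)"

definition vora_value :: "real^3^'n \<Rightarrow> real^3^'n \<Rightarrow> real^'n \<Rightarrow> real" where
  "vora_value Q X f = 1 / 3 * trace (projector (diag f ** Q) ** projector X)"

(* All partial derivatives of g exist at x and G is the column vector they form.  This is the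
   componentwise notion of gradient; GDERIV would in addition assert Frechet differentiability. *)
definition has_gradient :: "(real^'n \<Rightarrow> real) \<Rightarrow> real^'n \<Rightarrow> real^'n \<Rightarrow> bool" where
  "has_gradient g G x \<longleftrightarrow>
     (\<forall>i. ((\<lambda>t. g (\<chi> j. if j = i then t else x $ j)) has_real_derivative G $ i) (at (x $ i)))"

end

theory Submission
  imports Defs
begin

text \<open>Varying one entry of f moves A = FQ along A' = KA with K diagonal. Differentiating
  P = A H A^T with H = (A^T A)^-1, where H' = - H (A^T A)' H, gives
  P' = (I - P) K P + P K (I - P). Since P and P{X} are symmetric, both summands contribute
  tr (K P P{X} (I - P)) to the trace of P' P{X}.\<close>

section \<open>Product rules for matrix-valued functions\<close>

lemma bounded_bilinear_matrix_matrix_mult: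
  "bounded_bilinear ((**) :: real^'n^'m \<Rightarrow> real^'p^'n \<Rightarrow> real^'p^'m)"
proof -
  have "bilinear ((**) :: real^'n^'m \<Rightarrow> real^'p^'n \<Rightarrow> real^'p^'m)"
    by (auto simp: bilinear_def vec_eq_iff matrix_matrix_mult_def algebra_simps sum.distrib
        sum_distrib_left intro!: linearI)
  then show ?thesis
    by (simp add: bilinear_conv_bounded_bilinear)
qed

lemma bounded_linear_transpose: "bounded_linear (transpose :: real^'n^'m \<Rightarrow> real^'m^'n)"
  by (auto simp: linear_conv_bounded_linear[symmetric] transpose_def vec_eq_iff intro!: linearI)

lemma bounded_linear_trace: "bounded_linear (trace :: real^'n^'n \<Rightarrow> real)"
  by (auto simp: linear_conv_bounded_linear[symmetric] trace_def sum.distrib sum_distrib_left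
      intro!: linearI)

lemmas has_vector_derivative_matrix_matrix_mult =
  bounded_bilinear.has_vector_derivative[OF bounded_bilinear_matrix_matrix_mult]
lemmas has_vector_derivative_transpose =
  bounded_linear.has_vector_derivative[OF bounded_linear_transpose]

section \<open>Continuity and differentiability of the matrix inverse\<close>

text \<open>For square matrices a right inverse is also a left inverse. This makes \<open>A\<close>
  invertible, so the matrix chosen by \<open>matrix_inv\<close> really inverts \<open>A\<close>, and
  associativity identifies it with \<open>B\<close>.\<close>

lemma matrix_inv_unique:
  fixes A B :: "real^'n^'n"
  assumes "A ** B = mat 1"
  shows "matrix_inv A = B"
proof -
  have BA: "B ** A = mat 1"
    using assms matrix_left_right_inverse by blast
  have "invertible A"
    using assms BA invertible_def by blast
  then have "A ** matrix_inv A = mat 1"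
    by (simp add: matrix_inv_def invertible_def) (metis (mono_tags, lifting) someI_ex)
  then show ?thesis
    by (metis BA matrix_mul_assoc matrix_mul_lid matrix_mul_rid)
qed

lemma
  fixes A :: "real^'n^'n"
  assumes "invertible A"
  shows invertible_mult_matrix_inv: "A ** matrix_inv A = mat 1"
    and matrix_inv_mult_invertible: "matrix_inv A ** A = mat 1"
  using assms matrix_inv_unique unfolding invertible_def by metis+

lemma transpose_matrix_inv:
  fixes A :: "real^'n^'n"
  assumes "invertible A"
  shows "transpose (matrix_inv A) = matrix_inv (transpose A)"
  by (metis assms matrix_inv_mult_invertible matrix_inv_unique matrix_transpose_mul transpose_mat)

text \<open>Cramer's rule reduces the continuity of inversion to that of determinants, which are
  polynomials in the entries.\<close>

lemma matrix_inv_nth_cramer: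
  fixes A :: "real^'n^'n"
  assumes "invertible A"
  shows "matrix_inv A $ k $ l = det (\<chi> i j. if j = k then mat 1 $ i $ l else A $ i $ j) / det A"
proof -
  \<comment> \<open>Column \<open>l\<close> of the inverse solves the linear system whose right-hand
    side is the \<open>l\<close>-th unit vector.\<close>
  have "A *v column l (matrix_inv A) = (\<chi> i. mat 1 $ i $ l)"
    using invertible_mult_matrix_inv[OF assms]
    by (simp add: vec_eq_iff column_def matrix_vector_mult_def matrix_matrix_mult_def)
  then have "det (\<chi> i j. if j = k then mat 1 $ i $ l else A $ i $ j) = matrix_inv A $ k $ l * det A"
    using cramer_lemma[of k A "column l (matrix_inv A)"] by (simp add: column_def cong: if_cong)
  then show ?thesis
    using assms by (simp add: invertible_det_nz)
qed

lemma tendsto_det: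
  fixes M :: "'a \<Rightarrow> real^'n^'n"
  assumes "(M \<longlongrightarrow> A) F"
  shows "((\<lambda>x. det (M x)) \<longlongrightarrow> det A) F"
  unfolding det_def by (intro tendsto_intros assms)

lemma eventually_invertible:
  fixes M :: "'a \<Rightarrow> real^'n^'n"
  assumes "(M \<longlongrightarrow> A) F" "invertible A"
  shows "\<forall>\<^sub>F x in F. invertible (M x)"
  using tendsto_imp_eventually_ne[OF tendsto_det[OF assms(1)], of 0] assms(2)
  by (simp add: invertible_det_nz)

text \<open>Each entry of the inverse is a quotient of determinants with nonzero limit in the
  denominator. Cramer's rule applies to \<open>M x\<close> only where it is invertible, which holds
  eventually.\<close>

lemma tendsto_matrix_inv:
  fixes M :: "'a \<Rightarrow> real^'n^'n"
  assumes M: "(M \<longlongrightarrow> A) F" and A: "invertible A"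
  shows "((\<lambda>x. matrix_inv (M x)) \<longlongrightarrow> matrix_inv A) F"
proof (intro vec_tendstoI)
  fix k l
  have *: "((\<lambda>x. \<chi> i j. if j = k then mat 1 $ i $ l else M x $ i $ j) \<longlongrightarrow>
        (\<chi> i j. if j = k then mat 1 $ i $ l else A $ i $ j)) F"
    by (intro vec_tendstoI) (auto intro!: tendsto_intros M)
  have "((\<lambda>x. det (\<chi> i j. if j = k then mat 1 $ i $ l else M x $ i $ j) / det (M x)) \<longlongrightarrow>
        matrix_inv A $ k $ l) F"
    unfolding matrix_inv_nth_cramer[OF A]
    using A by (intro tendsto_divide tendsto_det * M) (simp add: invertible_det_nz)
  then show "((\<lambda>x. matrix_inv (M x) $ k $ l) \<longlongrightarrow> matrix_inv A $ k $ l) F"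
    by (rule Lim_transform_eventually)
      (rule eventually_mono[OF eventually_invertible[OF M A]], simp add: matrix_inv_nth_cramer)
qed

lemma has_vector_derivative_iff_slope:
  fixes g :: "real \<Rightarrow> 'a::real_normed_vector"
  shows "(g has_vector_derivative D) (at x) \<longleftrightarrow>
    ((\<lambda>t. (g t - g x) /\<^sub>R (t - x)) \<longlongrightarrow> D) (at x)"
proof -
  \<comment> \<open>The library divides the remainder by \<open>norm (t - x)\<close>, the slope
    divides by \<open>t - x\<close>; the two differ by a sign at most, which the norm
    removes.\<close>
  have "norm ((g t - g x - (t - x) *\<^sub>R D) /\<^sub>R norm (t - x)) = norm ((g t - g x) /\<^sub>R (t - x) - D)"
    if "t \<noteq> x" for t
  proof -
    have "(g t - g x) /\<^sub>R (t - x) - D = (g t - g x - (t - x) *\<^sub>R D) /\<^sub>R (t - x)"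
      using that by (simp add: scaleR_diff_right)
    then show ?thesis
      by simp
  qed
  then have "((\<lambda>t. norm ((g t - g x - (t - x) *\<^sub>R D) /\<^sub>R norm (t - x))) \<longlongrightarrow> 0) (at x) \<longleftrightarrow>
      ((\<lambda>t. norm ((g t - g x) /\<^sub>R (t - x) - D)) \<longlongrightarrow> 0) (at x)"
    by (intro filterlim_cong refl) (simp add: eventually_at_filter)
  then show ?thesis
    unfolding has_vector_derivative_def has_derivative_at_within tendsto_norm_zero_iff
    by (simp add: bounded_linear_scaleR_left LIM_zero_iff)
qed

text \<open>For N = \<open>M t\<close> and L = \<open>M x\<close>, the identity N^-1 (N - L) L^-1 =
  L^-1 - N^-1 expresses the difference quotient of the inverse through that of \<open>M\<close>.
  Continuity of inversion then gives the limit.\<close>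

lemma has_vector_derivative_matrix_inv:
  fixes M :: "real \<Rightarrow> real^'n^'n"
  assumes M: "(M has_vector_derivative M') (at x)" and inv: "invertible (M x)"
  shows "((\<lambda>t. matrix_inv (M t)) has_vector_derivative
      - (matrix_inv (M x) ** M' ** matrix_inv (M x))) (at x)"
proof -
  interpret bounded_bilinear "(**) :: real^'n^'n \<Rightarrow> real^'n^'n \<Rightarrow> real^'n^'n"
    by (rule bounded_bilinear_matrix_matrix_mult)
  have lim: "(M \<longlongrightarrow> M x) (at x)"
    using has_vector_derivative_continuous[OF M] by (simp add: continuous_at)
  have "((\<lambda>t. - (matrix_inv (M t) ** ((M t - M x) /\<^sub>R (t - x)) ** matrix_inv (M x))) \<longlongrightarrow>
      - (matrix_inv (M x) ** M' ** matrix_inv (M x))) (at x)"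
    using M unfolding has_vector_derivative_iff_slope
    by (intro tendsto_minus tendsto tendsto_matrix_inv lim inv tendsto_const)
  moreover have "- (matrix_inv (M t) ** ((M t - M x) /\<^sub>R (t - x)) ** matrix_inv (M x)) =
      (matrix_inv (M t) - matrix_inv (M x)) /\<^sub>R (t - x)" if "invertible (M t)" for t
  proof -
    have "matrix_inv (M t) ** (M t - M x) ** matrix_inv (M x) = matrix_inv (M x) - matrix_inv (M t)"
      by (simp add: diff_left diff_right matrix_inv_mult_invertible that
          invertible_mult_matrix_inv inv flip: matrix_mul_assoc)
    then show ?thesis
      by (simp add: scaleR_left scaleR_right flip: scaleR_minus_right)
  qed
  ultimately show ?thesis
    unfolding has_vector_derivative_iff_slope
    by (rule Lim_transform_eventually[OF _ eventually_mono[OF eventually_invertible[OF lim inv]]])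
qed

section \<open>Gram matrices and projectors\<close>

text \<open>The inner product of x with M^T M x is the squared norm of M x, so the kernel of the
  Gram matrix is that of \<open>M\<close>, which is trivial at full column rank.\<close>

lemma invertible_gram:
  fixes M :: "real^'k^'n"
  assumes "rank M = CARD('k)"
  shows "invertible (transpose M ** M)"
proof -
  have "x = 0" if "(transpose M ** M) *v x = 0" for x
  proof -
    have "(M *v x) \<bullet> (M *v x) = x \<bullet> ((transpose M ** M) *v x)"
      by (metis dot_lmul_matrix inner_commute matrix_vector_mul_assoc transpose_matrix_vector)
    then have "M *v x = M *v 0"
      using that by simp
    then show ?thesis
      using assms by (metis full_rank_injective injD)
  qed
  then show ?thesis
    using invertible_left_inverse matrix_left_invertible_ker by blast
qed

lemma transpose_projector:
  fixes M :: "real^'k^'n"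
  assumes "rank M = CARD('k)"
  shows "transpose (projector M) = projector M"
  using transpose_matrix_inv[OF invertible_gram[OF assms]]
  by (simp add: projector_def matrix_transpose_mul matrix_mul_assoc)


text \<open>Writing the derivative of \<open>A\<close> as \<open>K ** A x\<close> lets every factor
  be absorbed into \<open>P\<close>: the product rule yields K P + P K^T - P K P - P K^T P, which
  regroups as stated.\<close>

lemma has_vector_derivative_projector:
  fixes A :: "real \<Rightarrow> real^'k^'n"
  assumes A: "(A has_vector_derivative K ** A x) (at x)" and rank: "rank (A x) = CARD('k)"
  defines "P \<equiv> projector (A x)"
  shows "((\<lambda>t. projector (A t)) has_vector_derivative
    (mat 1 - P) ** K ** P + P ** transpose K ** (mat 1 - P)) (at x)"
proof -
  define H where "H = matrix_inv (transpose (A x) ** A x)"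
  note mult = has_vector_derivative_matrix_matrix_mult
  note AT = has_vector_derivative_transpose[OF A]
  \<comment> \<open>This is the raw output of the product rule and the inverse rule, left
    unsimplified so that the rules match it syntactically.\<close>
  have diff: "((\<lambda>t. projector (A t)) has_vector_derivative
      A x ** H ** transpose (K ** A x) +
      (A x ** - (H ** (transpose (A x) ** (K ** A x) + transpose (K ** A x) ** A x) ** H) +
        K ** A x ** H) ** transpose (A x)) (at x)"
    unfolding projector_def H_def
    by (intro mult A AT has_vector_derivative_matrix_inv invertible_gram rank)
  show ?thesis
    by (rule has_vector_derivative_eq_rhs[OF diff])
      (simp add: P_def projector_def H_def[symmetric] matrix_transpose_mul matrix_mul_assoc
        bounded_bilinear.add_left[OF bounded_bilinear_matrix_matrix_mult]
        bounded_bilinear.add_right[OF bounded_bilinear_matrix_matrix_mult]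
        bounded_bilinear.diff_left[OF bounded_bilinear_matrix_matrix_mult]
        bounded_bilinear.diff_right[OF bounded_bilinear_matrix_matrix_mult]
        bounded_bilinear.minus_left[OF bounded_bilinear_matrix_matrix_mult]
        bounded_bilinear.minus_right[OF bounded_bilinear_matrix_matrix_mult])
qed

section \<open>Traces and diagonal matrices\<close>

lemma trace_transpose: "trace (transpose A) = trace A"
  by (simp add: trace_def transpose_def)

lemma diag_mult_nth: "(diag f ** M) $ i $ j = f $ i * M $ i $ j"
  by (simp add: diag_def matrix_matrix_mult_def if_distribR if_distrib cong: if_cong)

lemma diag_mult_diag: "diag f ** diag g = diag (\<chi> i. f $ i * g $ i)"
  by (simp add: vec_eq_iff diag_mult_nth) (simp add: diag_def)

lemma transpose_diag: "transpose (diag f) = diag f"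
  by (simp add: diag_def transpose_def vec_eq_iff)

text \<open>Turns the trace in the derivative of the Vora-Value into a single diagonal entry, the
  source of \<open>ediag\<close> in the gradient.\<close>

lemma trace_diag_axis_mult: "trace (diag (axis i c) ** N) = c * N $ i $ i"
  by (simp add: trace_def diag_mult_nth axis_def if_distribR if_distrib cong: if_cong)

lemma diag_inverse_right:
  assumes "\<And>i. f $ i \<noteq> 0"
  shows "diag f ** diag (\<chi> i. inverse (f $ i)) = mat 1"
  using assms unfolding diag_mult_diag by (simp add: diag_def mat_def vec_eq_iff)

text \<open>Full column rank means injectivity, and an invertible diagonal factor preserves it.
  Hence the projector calculus applies to FQ.\<close>

lemma rank_diag_mult:
  fixes Q :: "real^'k^'n"
  assumes "\<And>i. f $ i \<noteq> 0" and "rank Q = CARD('k)"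
  shows "rank (diag f ** Q) = CARD('k)"
proof -
  have "inj ((*v) (diag f))"
    using diag_inverse_right[OF assms(1)] invertible_right_inverse inj_matrix_vector_mult by blast
  then have "inj ((*v) (diag f) \<circ> (*v) Q)"
    using assms(2) by (intro inj_compose) (simp_all add: full_rank_injective)
  then show ?thesis
    by (simp add: full_rank_injective o_def matrix_vector_mul_assoc)
qed

theorem theorem1:
  fixes Q X :: "real^3^'n" and f :: "real^'n"
  assumes "CARD('n) \<ge> 3"
    and "rank Q = 3"
    and "rank X = 3"
    and "\<forall>i. f $ i > 0"
  shows "has_gradient (vora_value Q X)
    ((2 / 3) *\<^sub>R ediag (matrix_inv (diag f) ** projector (diag f ** Q) ** projector X
        ** (mat 1 - projector (diag f ** Q)))) f"
  unfolding has_gradient_def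
proof
  fix i
  define P where "P = projector (diag f ** Q)"
  define Y where "Y = projector X"
  define N where "N = P ** Y ** (mat 1 - P)"
  \<comment> \<open>The factor \<open>inverse (f $ i)\<close> cancels the entry \<open>f $ i\<close>
    of F, so that K F is the matrix unit at (i, i), the derivative of F in its \<open>i\<close>-th
    entry.\<close>
  define K where "K = diag (axis i (inverse (f $ i)))"
  define A where "A t = diag (\<chi> j. if j = i then t else f $ j) ** Q" for t
  have f0: "f $ j \<noteq> 0" for j
    using assms(4) by (metis less_irrefl)
  have rank: "rank (diag f ** Q) = CARD(3)"
    using rank_diag_mult[OF f0, of Q] assms(2) by simp
  have PT: "transpose P = P" and YT: "transpose Y = Y"
    unfolding P_def Y_def using transpose_projector[OF rank] transpose_projector[of X] assms(3)
    by simp_all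
  have Af: "A (f $ i) = diag f ** Q"
    by (simp add: A_def vec_eq_iff diag_mult_nth)
  \<comment> \<open>\<open>A\<close> is affine in \<open>t\<close>, so its derivative can be read
    off without a limit.\<close>
  have A_eq: "A t = A (f $ i) + (t - f $ i) *\<^sub>R (K ** A (f $ i))" for t
    unfolding Af by (simp add: A_def K_def vec_eq_iff diag_mult_nth axis_def f0 field_simps)
  have "(A has_vector_derivative K ** A (f $ i)) (at (f $ i))"
    by (subst A_eq[abs_def], rule has_vector_derivative_eq_rhs)
      (rule derivative_intros | simp)+
  from has_vector_derivative_projector[OF this] rank
  have "((\<lambda>t. projector (A t)) has_vector_derivative
      (mat 1 - P) ** K ** P + P ** K ** (mat 1 - P)) (at (f $ i))"
    by (simp add: Af P_def K_def transpose_diag)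
  then have "((\<lambda>t. trace (projector (A t) ** Y)) has_vector_derivative
      trace (((mat 1 - P) ** K ** P + P ** K ** (mat 1 - P)) ** Y)) (at (f $ i))"
    by (intro bounded_linear.has_vector_derivative[OF bounded_linear_trace]
        bounded_linear.has_vector_derivative
          [OF bounded_bilinear.bounded_linear_left[OF bounded_bilinear_matrix_matrix_mult]])
  moreover have "trace (((mat 1 - P) ** K ** P + P ** K ** (mat 1 - P)) ** Y) = 2 * trace (K ** N)"
  proof -
    \<comment> \<open>Cyclicity of the trace moves \<open>mat 1 - P\<close> to the end.\<close>
    have "trace ((mat 1 - P) ** K ** P ** Y) = trace (K ** N)"
      unfolding N_def by (metis matrix_mul_assoc trace_mul_sym)
    moreover have "trace (P ** K ** (mat 1 - P) ** Y) = trace (K ** N)"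
    proof -
      have "transpose (mat 1 - P) = mat 1 - P"
        using PT by (simp add: transpose_def vec_eq_iff mat_def)
      \<comment> \<open>Transposition preserves the trace and reverses the product of symmetric
        factors; cyclicity then brings \<open>K\<close> to the front.\<close>
      then have "transpose (P ** K ** (mat 1 - P) ** Y) = Y ** (mat 1 - P) ** K ** P"
        by (simp add: matrix_transpose_mul PT YT K_def transpose_diag matrix_mul_assoc)
      then show ?thesis
        unfolding N_def by (metis matrix_mul_assoc trace_mul_sym trace_transpose)
    qed
    ultimately show ?thesis
      by (simp add: bounded_bilinear.add_left[OF bounded_bilinear_matrix_matrix_mult] trace_add)
  qed
  \<comment> \<open>Both sides equal \<open>N $ i $ i\<close> divided by \<open>f $ i\<close>, since
    F^-1 is diagonal with the inverted entries.\<close>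
  moreover have "trace (K ** N) = (matrix_inv (diag f) ** N) $ i $ i"
    unfolding matrix_inv_unique[OF diag_inverse_right[OF f0]]
    by (simp add: K_def trace_diag_axis_mult diag_mult_nth)
  ultimately have "((\<lambda>t. 1 / 3 * trace (projector (A t) ** Y)) has_real_derivative
      2 / 3 * (matrix_inv (diag f) ** N) $ i $ i) (at (f $ i))"
    by (auto simp: has_real_derivative_iff_has_vector_derivative[symmetric]
        intro!: derivative_eq_intros)
  then show "((\<lambda>t. vora_value Q X (\<chi> j. if j = i then t else f $ j)) has_real_derivative
      ((2 / 3) *\<^sub>R ediag (matrix_inv (diag f) ** projector (diag f ** Q) ** projector X
        ** (mat 1 - projector (diag f ** Q)))) $ i) (at (f $ i))"
    by (simp add: vora_value_def A_def Y_def N_def P_def ediag_def matrix_mul_assoc)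
qed

end
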